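(* Let $(a_0,a_1,a_2)=(1/2,1,1/2)$, let $s_k=1$ if $k$ is even and $s_k=0$ if $k$ is odd, and for $k\ge1$, $j\in\{0,1,2\}$ set $$C_k=\begin{pmatrix}1&0\\ s_k&1\end{pmatrix},\qquad B_j=\begin{pmatrix}0&0\\0&a_j\end{pmatrix},\qquad A_j^{[k]}=C_kB_jC_{k+1}^{-1}\in\mathbb R^{2\times2}.$$ Let $(V_kf)(x)=\sum_{j=0}^2A_j^{[k]}f(2x-j)$. Then there exist a compactly supported CPwL seed $g:\mathbb R\to\mathbb R^2$, a window and matching maps $P_k$ ($k\ge1$) for these masks and seed (as defined in the context) such that the defects satisfy $\delta_k=0$ for all $k$, the chronological radius is $\rho_{\rm ch}=\tfrac12$, and $V_1\cdots V_ng$ converges uniformly to some $\Phi\not\equiv0$, while the matching kernels $\ker P_k$ alternate (according to the parity of $k$) between two distinct subspaces.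
   Context: CPwL means continuous piecewise linear with finitely many breakpoints. In $V_1\cdots V_ng$ the rightmost operator acts first. Here $p=2$ and $J=\{0,1,2\}$; $A_j^{[k]}:=0$ for $j\notin J$. Window. Integers $\ell_-<\ell_+$ such that $[\ell_-,\ell_+]$ contains $J$, $\operatorname{supp}g$ and $[0,1]$, with $g(\ell_-)=g(\ell_+)=0$; $L=\ell_+-\ell_-$, $D=pL$. For $x\in[0,1]$, $G_f(x)=(f(x+\ell_-),\dots,f(x+\ell_+-1))^T\in\mathbb R^D$ (stacked $\mathbb R^p$-blocks). For $\epsilon\in\{0,1\}$, $T_\epsilon^{[k]}\in\mathbb R^{D\times D}$ has $p\times p$ blocks $[T^{[k]}_\epsilon]_{i\ell}=A^{[k]}_{\ell_-+2i-\ell-1+\epsilon}$, $1\le i,\ell\le L$. Matching maps. Matrices $P_k\in\mathbb R^{r\times D}$, $1\le r<D$, of full row rank with $\inf_k\sigma_{\min}(P_k)>0$ and $\sup_k\|P_k\|_2<\infty$. $U_k$ is a matrix whose columns are an orthonormal basis of $\ker P_k$, $S_k=[\,U_k\ \ P_k^\dagger\,]$ with $P_k^\dagger$ the Moore–Penrose pseudoinverse. Chronological radius. With $C_{k,\epsilon}=U_k^TT^{[k]}_\epsilon U_{k+1}$ and $\chi_m=\sup_{a\ge1}\max_{\epsilon_a,\dots,\epsilon_{a+m-1}\in\{0,1\}}\|C_{a,\epsilon_a}\cdots C_{a+m-1,\epsilon_{a+m-1}}\|$, $\rho_{\rm ch}=\lim_{m\to\infty}\chi_m^{1/m}$ (independent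 of the norm and of the bases $U_k$). Defect. $\delta_k=\max_{\epsilon\in\{0,1\}}\|(P_kT_\epsilon^{[k]}-P_{k+1})S_{k+1}\|_2+\sup_{t\in[0,1]}\|P_kG_{V_kg-g}(t)\|_2.$ *)

theory Defs
  imports
    "HOL-Analysis.Analysis"
    "Jordan_Normal_Form.Char_Poly"
    "Jordan_Normal_Form.Matrix_Kernel"
    "Jordan_Normal_Form.DL_Rank"
begin

text \<open>Objects of the fixed size \<open>p = 2\<close> live in \<open>real ^ 2\<close> and \<open>real ^ 2 ^ 2\<close>; matrices whose
  size depends on the window or on \<open>r\<close> are matrices of \<open>Jordan_Normal_Form\<close> (indices from 0).\<close>

no_notation Matrix.vec_index (infixl \<open>$\<close> 100)
no_notation Inner_Product.real_inner_class.inner (infix \<open>\<bullet>\<close> 70)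
hide_const (open) Finite_Cartesian_Product.mat Finite_Cartesian_Product.vec

definition vnorm :: "real vec \<Rightarrow> real" where
  "vnorm v = sqrt (v \<bullet> v)"

definition opnorm :: "real mat \<Rightarrow> real" where
  "opnorm A = (SUP x\<in>{x \<in> carrier_vec (dim_col A). vnorm x \<le> 1}. vnorm (A *\<^sub>v x))"

text \<open>An \<open>m \<times> n\<close> matrix has \<open>min m n\<close> singular values, the square roots of the eigenvalues of the
  smaller of its two Gram matrices.\<close>

definition sigma_min :: "real mat \<Rightarrow> real" where
  "sigma_min A = Min (sqrt ` {\<mu>. eigenvalue
     (if dim_row A \<le> dim_col A then A * transpose_mat A else transpose_mat A * A) \<mu>})"

definition is_pseudoinverse :: "real mat \<Rightarrow> real mat \<Rightarrow> bool" where
  "is_pseudoinverse A X \<longleftrightarrow> X \<in> carrier_mat (dim_col A) (dim_row A)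
     \<and> A * X * A = A \<and> X * A * X = X
     \<and> transpose_mat (A * X) = A * X \<and> transpose_mat (X * A) = X * A"

definition pseudoinverse :: "real mat \<Rightarrow> real mat" where
  "pseudoinverse A = (THE X. is_pseudoinverse A X)"

definition kernel_onb :: "real mat \<Rightarrow> real mat \<Rightarrow> bool" where
  "kernel_onb P U \<longleftrightarrow> dim_row U = dim_col P
     \<and> (\<forall>i<dim_col U. \<forall>j<dim_col U. col U i \<bullet> col U j = (if i = j then 1 else 0))
     \<and> LinearCombinations.module.span class_ring (module_vec TYPE(real) (dim_col P)) (set (cols U))
         = mat_kernel P"

definition supp :: "(real \<Rightarrow> real ^ 2) \<Rightarrow> real set" where
  "supp g = closure {x. g x \<noteq> 0}"

definition cpwl :: "(real \<Rightarrow> real ^ 2) \<Rightarrow> bool" where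
  "cpwl g \<longleftrightarrow> continuous_on UNIV g \<and>
     (\<exists>B. finite B \<and>
        (\<forall>I. is_interval I \<and> I \<inter> B = {} \<longrightarrow> (\<exists>u v. \<forall>x\<in>I. g x = u + x *\<^sub>R v)))"

text \<open>Masks are written \<open>A k j\<close> for \<open>A\<^sub>j\<^sup>[\<^sup>k\<^sup>]\<close>, with \<open>k \<ge> 1\<close>.\<close>

type_synonym masks = "nat \<Rightarrow> int \<Rightarrow> real ^ 2 ^ 2"

definition V_op :: "masks \<Rightarrow> nat \<Rightarrow> (real \<Rightarrow> real ^ 2) \<Rightarrow> real \<Rightarrow> real ^ 2" where
  "V_op A k f x = (\<Sum>j\<in>{0, 1, 2}. A k j *v f (2 * x - of_int j))"

definition is_window :: "(real \<Rightarrow> real ^ 2) \<Rightarrow> int \<Rightarrow> int \<Rightarrow> bool" where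
  "is_window g lm lp \<longleftrightarrow> lm < lp
     \<and> {0, 1, 2} \<subseteq> {real_of_int lm..real_of_int lp}
     \<and> supp g \<subseteq> {real_of_int lm..real_of_int lp}
     \<and> {0..1} \<subseteq> {real_of_int lm..real_of_int lp}
     \<and> g (of_int lm) = 0 \<and> g (of_int lp) = 0"

definition wdim :: "int \<Rightarrow> int \<Rightarrow> nat" where
  "wdim lm lp = 2 * nat (lp - lm)"

text \<open>Row \<open>n\<close> of a stacked vector is component \<open>component n\<close> of block \<open>n div 2\<close>.\<close>

definition component :: "nat \<Rightarrow> 2" where
  "component n = (if even n then 1 else 2)"

definition G_vec :: "int \<Rightarrow> int \<Rightarrow> (real \<Rightarrow> real ^ 2) \<Rightarrow> real \<Rightarrow> real vec" where
  "G_vec lm lp f x = Matrix.vec (wdim lm lp)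
     (\<lambda>n. f (x + of_int lm + real (n div 2)) $ component n)"

text \<open>With 0-based blocks \<open>i\<close>, \<open>l\<close>, the 1-based index \<open>l\<^sub>- + 2i - l - 1 + \<epsilon>\<close> is
  \<open>l\<^sub>- + 2(i + 1) - (l + 1) - 1 + \<epsilon>\<close>.\<close>

definition T_mat :: "masks \<Rightarrow> int \<Rightarrow> int \<Rightarrow> nat \<Rightarrow> int \<Rightarrow> real mat" where
  "T_mat A lm lp k \<epsilon> = Matrix.mat (wdim lm lp) (wdim lm lp)
     (\<lambda>(m, n). A k (lm + 2 * (int (m div 2) + 1) - (int (n div 2) + 1) - 1 + \<epsilon>) $ component m $ component n)"

definition matching_maps :: "nat \<Rightarrow> nat \<Rightarrow> (nat \<Rightarrow> real mat) \<Rightarrow> bool" where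
  "matching_maps D r P \<longleftrightarrow> 1 \<le> r \<and> r < D
     \<and> (\<forall>k\<ge>1. P k \<in> carrier_mat r D \<and> vec_space.rank r (P k) = r)
     \<and> (\<exists>c>0. \<forall>k\<ge>1. c \<le> sigma_min (P k))
     \<and> (\<exists>c. \<forall>k\<ge>1. opnorm (P k) \<le> c)"

definition chron_factor ::
  "(nat \<Rightarrow> int \<Rightarrow> real mat) \<Rightarrow> (nat \<Rightarrow> real mat) \<Rightarrow> nat \<Rightarrow> int \<Rightarrow> real mat" where
  "chron_factor M U k \<epsilon> = transpose_mat (U k) * M k \<epsilon> * U (k + 1)"

fun chron_product ::
  "(nat \<Rightarrow> int \<Rightarrow> real mat) \<Rightarrow> (nat \<Rightarrow> real mat) \<Rightarrow> nat \<Rightarrow> int list \<Rightarrow> real mat" where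
  "chron_product M U a [] = 1\<^sub>m (dim_col (U a))"
| "chron_product M U a (\<epsilon> # es) = chron_factor M U a \<epsilon> * chron_product M U (a + 1) es"

definition chi :: "(nat \<Rightarrow> int \<Rightarrow> real mat) \<Rightarrow> (nat \<Rightarrow> real mat) \<Rightarrow> nat \<Rightarrow> real" where
  "chi M U m = (SUP a\<in>{1..}. MAX es\<in>{es. length es = m \<and> set es \<subseteq> {0, 1}}.
     opnorm (chron_product M U a es))"

definition has_chron_radius ::
  "(nat \<Rightarrow> int \<Rightarrow> real mat) \<Rightarrow> (nat \<Rightarrow> real mat) \<Rightarrow> real \<Rightarrow> bool" where
  "has_chron_radius M U \<rho> \<longleftrightarrow> (\<lambda>m. root m (chi M U m)) \<longlonglongrightarrow> \<rho>"

definition S_mat :: "(nat \<Rightarrow> real mat) \<Rightarrow> (nat \<Rightarrow> real mat) \<Rightarrow> nat \<Rightarrow> real mat" where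
  "S_mat P U k = mat_of_cols (dim_col (P k)) (cols (U k) @ cols (pseudoinverse (P k)))"

definition defect :: "masks \<Rightarrow> (real \<Rightarrow> real ^ 2) \<Rightarrow> int \<Rightarrow> int
    \<Rightarrow> (nat \<Rightarrow> real mat) \<Rightarrow> (nat \<Rightarrow> real mat) \<Rightarrow> nat \<Rightarrow> real" where
  "defect A g lm lp P U k =
     (MAX \<epsilon>\<in>{0, 1}. opnorm ((P k * T_mat A lm lp k \<epsilon> - P (k + 1)) * S_mat P U (k + 1)))
     + (SUP t\<in>{0..1}. vnorm (P k *\<^sub>v G_vec lm lp (\<lambda>x. V_op A k g x - g x) t))"

definition a_coeff :: "int \<Rightarrow> real" where
  "a_coeff j = (if j = 1 then 1 else 1 / 2)"

definition C_mat :: "nat \<Rightarrow> real ^ 2 ^ 2" where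
  "C_mat k = vector [vector [1, 0], vector [if even k then 1 else 0, 1]]"

definition B_mat :: "int \<Rightarrow> real ^ 2 ^ 2" where
  "B_mat j = vector [vector [0, 0], vector [0, a_coeff j]]"

definition switching_mask :: masks where
  "switching_mask k j =
     (if j \<in> {0, 1, 2} then C_mat k ** B_mat j ** matrix_inv (C_mat (k + 1)) else 0)"

end

theory Submission
  imports Defs
begin

text \<open>Writing \<open>w\<^sub>k = (- s\<^sub>k, 1)\<close>, the masks are \<open>a\<^sub>j\<close> times the rank-one matrix \<open>e\<^sub>2 w\<^sup>T\<close> with
  \<open>w = w\<^sub>k\<^sub>+\<^sub>1\<close>. Hence the seed \<open>(0, h)\<close>, with \<open>h\<close> the hat function on \<open>[0, 2]\<close>, is fixed by every
  \<open>V\<^sub>k\<close>. On the window \<open>[0, 2]\<close> the transition matrices are tensor products of the two scalar hat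
  transition matrices, whose columns sum to 1, with \<open>e\<^sub>2 w\<^sup>T\<close>; so the row vectors
  \<open>P\<^sub>k = (w\<^sub>k, w\<^sub>k)\<close> satisfy \<open>P\<^sub>k T = P\<^sub>k\<^sub>+\<^sub>1\<close>. On \<open>ker P\<^sub>k\<^sub>+\<^sub>1\<close> each transition matrix is
  \<open>x \<mapsto> \<phi>\<^sub>k\<^sub>+\<^sub>1(x)/2 \<cdot> v\<close>, where \<open>\<phi>\<^sub>k(x) = w\<^sub>k \<cdot> (x\<^sub>0, x\<^sub>1)\<close>,
  \<open>v = (0, 1, 0, -1)\<close> lies in all the kernels and \<open>\<phi>\<^sub>k(v) = 1\<close>,
  so a chronological product of length \<open>m\<close> is \<open>2\<^sup>-\<^sup>m\<close> times an operator of norm between two constants.\<close>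

section \<open>Euclidean norm and operator norm\<close>

lemma vnorm_zero [simp]: "vnorm (0\<^sub>v n) = 0"
  by (simp add: vnorm_def)

lemma vnorm_smult: "vnorm (c \<cdot>\<^sub>v v) = \<bar>c\<bar> * vnorm v"
proof -
  have "(c \<cdot>\<^sub>v v) \<bullet> (c \<cdot>\<^sub>v v) = c\<^sup>2 * (v \<bullet> v)"
    by (simp add: power2_eq_square)
  then show ?thesis
    by (simp add: vnorm_def real_sqrt_mult)
qed

lemma opnorm_le:
  assumes "\<And>x. x \<in> carrier_vec (dim_col A) \<Longrightarrow> vnorm (A *\<^sub>v x) \<le> c * vnorm x" and "0 \<le> c"
  shows "opnorm A \<le> c"
  unfolding opnorm_def
proof (rule cSUP_least)
  have "0\<^sub>v (dim_col A) \<in> {x \<in> carrier_vec (dim_col A). vnorm x \<le> 1}"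
    by simp
  then show "{x \<in> carrier_vec (dim_col A). vnorm x \<le> 1} \<noteq> {}"
    by blast
next
  fix x assume "x \<in> {x \<in> carrier_vec (dim_col A). vnorm x \<le> 1}"
  then show "vnorm (A *\<^sub>v x) \<le> c"
    using assms(1)[of x] mult_left_mono[OF _ assms(2), of "vnorm x" 1] by auto
qed

text \<open>The constant \<open>c\<close> certifies that the supremum in \<open>opnorm\<close> is
  taken over a bounded set, as a conditionally complete order requires.\<close>

lemma vnorm_mult_le_opnorm:
  assumes bound: "\<And>x. x \<in> carrier_vec (dim_col A) \<Longrightarrow> vnorm (A *\<^sub>v x) \<le> c * vnorm x" "0 \<le> c"
    and "x \<in> carrier_vec (dim_col A)" "vnorm x \<le> 1"
  shows "vnorm (A *\<^sub>v x) \<le> opnorm A"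
  unfolding opnorm_def
proof (rule cSUP_upper)
  show "bdd_above ((\<lambda>x. vnorm (A *\<^sub>v x)) ` {x \<in> carrier_vec (dim_col A). vnorm x \<le> 1})"
  proof (rule bdd_aboveI2)
    fix x assume "x \<in> {x \<in> carrier_vec (dim_col A). vnorm x \<le> 1}"
    then show "vnorm (A *\<^sub>v x) \<le> c"
      using bound(1)[of x] mult_left_mono[OF _ bound(2), of "vnorm x" 1] by auto
  qed
qed (use assms in auto)

lemma opnorm_zero [simp]: "opnorm (0\<^sub>m m n) = 0"
proof (rule antisym)
  have z: "0\<^sub>m m n *\<^sub>v x = 0\<^sub>v m" if "x \<in> carrier_vec n" for x :: "real vec"
    using that by (intro eq_vecI) auto
  show "opnorm (0\<^sub>m m n) \<le> 0"
    by (rule opnorm_le) (use z in auto)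
  show "0 \<le> opnorm (0\<^sub>m m n)"
    using vnorm_mult_le_opnorm[of "0\<^sub>m m n" 0 "0\<^sub>v n"] z by auto
qed

section \<open>Orthonormal bases of a kernel\<close>

text \<open>The column space is the range of \<open>U\<close>, and the Gram matrix collects the
  inner products of the columns. From here on matrix algebra replaces spans.\<close>

lemma kernel_onb_iff:
  "kernel_onb P U \<longleftrightarrow> dim_row U = dim_col P \<and> transpose_mat U * U = 1\<^sub>m (dim_col U)
     \<and> mat_kernel P = (\<lambda>y. U *\<^sub>v y) ` carrier_vec (dim_col U)"
proof (cases "dim_row U = dim_col P")
  case True
  then have U: "U \<in> carrier_mat (dim_col P) (dim_col U)"
    by auto
  have "LinearCombinations.module.span class_ring (module_vec TYPE(real) (dim_col P)) (set (cols U))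
      = {x \<in> carrier_vec (dim_row U). \<exists>y\<in>carrier_vec (dim_col U). U *\<^sub>v y = x}"
    using vec_space.col_space_eq[OF U] unfolding vec_space.col_space_def .
  also have "\<dots> = (\<lambda>y. U *\<^sub>v y) ` carrier_vec (dim_col U)"
  proof -
    have "U *\<^sub>v y \<in> carrier_vec (dim_row U)" for y
      by (rule carrier_vecI) simp
    then show ?thesis
      by blast
  qed
  finally have "LinearCombinations.module.span class_ring (module_vec TYPE(real) (dim_col P)) (set (cols U))
      = (\<lambda>y. U *\<^sub>v y) ` carrier_vec (dim_col U)" .
  moreover have "transpose_mat U * U = 1\<^sub>m (dim_col U) \<longleftrightarrow>
      (\<forall>i<dim_col U. \<forall>j<dim_col U. col U i \<bullet> col U j = (if i = j then 1 else 0))"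
    by (auto simp: mat_eq_iff)
  ultimately show ?thesis
    using True unfolding kernel_onb_def by metis
qed (simp add: kernel_onb_def)

lemma kernel_onb_mult:
  assumes "kernel_onb P U" "y \<in> carrier_vec (dim_col U)"
  shows "U *\<^sub>v y \<in> mat_kernel P" "transpose_mat U *\<^sub>v (U *\<^sub>v y) = y" "vnorm (U *\<^sub>v y) = vnorm y"
proof -
  show "U *\<^sub>v y \<in> mat_kernel P"
    using assms unfolding kernel_onb_iff by blast
  have U: "U \<in> carrier_mat (dim_row U) (dim_col U)"
    by simp
  show inv: "transpose_mat U *\<^sub>v (U *\<^sub>v y) = y"
  proof -
    have "transpose_mat U *\<^sub>v (U *\<^sub>v y) = (transpose_mat U * U) *\<^sub>v y"
      by (rule assoc_mult_mat_vec[symmetric]) (use assms(2) in auto)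
    also have "transpose_mat U * U = 1\<^sub>m (dim_col U)"
      using assms(1) unfolding kernel_onb_iff by blast
    finally show ?thesis
      using assms(2) by simp
  qed
  have "(U *\<^sub>v y) \<bullet> (U *\<^sub>v y) = (transpose_mat U *\<^sub>v (U *\<^sub>v y)) \<bullet> y"
    by (rule transpose_vec_mult_scalar[OF U assms(2), symmetric]) (rule carrier_vecI, simp)
  then show "vnorm (U *\<^sub>v y) = vnorm y"
    by (simp add: inv vnorm_def)
qed

text \<open>A kernel vector has the form \<open>U *\<^sub>v y\<close>, and
  \<open>transpose_mat U\<close> recovers \<open>y\<close> isometrically.\<close>

lemma kernel_onb_transpose_mult:
  assumes "kernel_onb P U" "x \<in> mat_kernel P"
  shows "U *\<^sub>v (transpose_mat U *\<^sub>v x) = x" "vnorm (transpose_mat U *\<^sub>v x) = vnorm x"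
proof -
  obtain y where "y \<in> carrier_vec (dim_col U)" "x = U *\<^sub>v y"
    using assms unfolding kernel_onb_iff by blast
  with kernel_onb_mult[OF assms(1)] show "U *\<^sub>v (transpose_mat U *\<^sub>v x) = x"
    "vnorm (transpose_mat U *\<^sub>v x) = vnorm x"
    by auto
qed

section \<open>Closed form of the masks; \<open>shear k\<close> is s_k\<close>

definition shear :: "nat \<Rightarrow> real" where
  "shear k = (if even k then 1 else 0)"

text \<open>\<open>matrix_inv\<close> chooses some two-sided inverse X, and X = X(AB) = (XA)B = B
  leaves one choice.\<close>

lemma matrix_inv_unique:
  fixes A B :: "real ^ 'n ^ 'n"
  assumes "A ** B = Finite_Cartesian_Product.mat 1" "B ** A = Finite_Cartesian_Product.mat 1"
  shows "matrix_inv A = B"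
  unfolding matrix_inv_def
proof (rule some_equality)
  fix X assume "A ** X = Finite_Cartesian_Product.mat 1 \<and> X ** A = Finite_Cartesian_Product.mat 1"
  then show "X = B"
    by (metis assms(1) matrix_mul_assoc matrix_mul_lid matrix_mul_rid)
qed (use assms in simp)

lemma matrix_inv_C_mat:
  "matrix_inv (C_mat k) = vector [vector [1, 0], vector [- shear k, 1]]"
  by (rule matrix_inv_unique)
    (simp_all add: C_mat_def shear_def Finite_Cartesian_Product.vec_eq_iff forall_2 matrix_matrix_mult_def sum_2
      Finite_Cartesian_Product.mat_def)

text \<open>\<open>B_mat j\<close> is a_j e_2 e_2^T and \<open>C_mat k\<close> fixes e_2, so the
  left factor disappears; the right one turns e_2^T into w_{k+1}^T.\<close>

lemma switching_mask_eq:
  "switching_mask k j = (if j \<in> {0, 1, 2}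
     then vector [vector [0, 0], vector [- shear (k + 1) * a_coeff j, a_coeff j]] else 0)"
  unfolding switching_mask_def matrix_inv_C_mat
  by (simp add: C_mat_def B_mat_def Finite_Cartesian_Product.vec_eq_iff forall_2
      matrix_matrix_mult_def sum_2)

section \<open>The hat seed and its invariance\<close>

definition hat :: "real \<Rightarrow> real" where
  "hat x = max 0 (1 - \<bar>x - 1\<bar>)"

definition seed :: "real \<Rightarrow> real ^ 2" where
  "seed x = vector [0, hat x]"

lemma seed_eq: "seed x = hat x *\<^sub>R axis 2 1"
  by (simp add: seed_def Finite_Cartesian_Product.vec_eq_iff forall_2 axis_def)

lemma hat_refinement: "hat x = hat (2 * x) / 2 + hat (2 * x - 1) + hat (2 * x - 2) / 2"
  proof -
  \<comment> \<open>Both sides are affine between consecutive half-integers of [0, 2] and vanish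
    outside.\<close>
  consider "x \<le> 0" | "0 \<le> x" "x \<le> 1 / 2" | "1 / 2 \<le> x" "x \<le> 1" | "1 \<le> x" "x \<le> 3 / 2"
    | "3 / 2 \<le> x" "x \<le> 2" | "2 \<le> x"
    by linarith
  then show ?thesis
    by cases (auto simp: hat_def abs_if max_def field_simps)
qed

text \<open>Since w_{k+1} . (0, h) = h whatever the shear, the vector equation reduces to the scalar
  relation \<open>hat_refinement\<close>.\<close>

lemma V_op_seed: "V_op switching_mask k seed = seed"
proof
  fix x
  show "V_op switching_mask k seed x = seed x"
    using hat_refinement[of x]
    by (simp add: V_op_def switching_mask_eq seed_def Finite_Cartesian_Product.vec_eq_iff forall_2 a_coeff_def
        matrix_vector_mult_def sum_2)
qed

lemma foldr_V_op_seed: "foldr (V_op switching_mask) ks seed = seed"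
  by (induction ks) (simp_all add: V_op_seed)

lemma supp_seed: "supp seed \<subseteq> {0..2}"
  unfolding supp_def
proof (rule closure_minimal)
  show "{x. seed x \<noteq> 0} \<subseteq> {0..2}"
    by (auto simp: seed_eq hat_def max_def abs_if split: if_splits)
qed simp

lemma cpwl_seed: "cpwl seed"
  unfolding cpwl_def
proof (intro conjI exI[of _ "{0, 1, 2}"] allI impI)
  show "continuous_on UNIV seed"
    unfolding seed_eq hat_def by (intro continuous_intros)
  fix I :: "real set"
  assume I: "is_interval I \<and> I \<inter> {0, 1, 2} = {}"
  \<comment> \<open>By convexity an interval avoiding a breakpoint lies on one side of it.\<close>
  have side: "(\<forall>x\<in>I. x < b) \<or> (\<forall>x\<in>I. b < x)" if "b \<in> {0, 1, 2}" for b
  proof (rule ccontr)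
    assume "\<not> ?thesis"
    then obtain x y where "x \<in> I" "b \<le> x" "y \<in> I" "y \<le> b"
      by (meson not_less)
    then have "b \<in> I"
      using I unfolding is_interval_1 by blast
    with I that show False
      by blast
  qed
  have "\<exists>c d. \<forall>x\<in>I. hat x = c + x * d"
  proof -
    consider "\<forall>x\<in>I. x < 0" | "\<forall>x\<in>I. 0 < x \<and> x < 1" | "\<forall>x\<in>I. 1 < x \<and> x < 2" | "\<forall>x\<in>I. 2 < x"
      using side[of 0] side[of 1] side[of 2] by auto
    then show ?thesis
    proof cases
      case 1
      then show ?thesis
        by (intro exI[of _ 0]) (auto simp: hat_def)
    next
      case 2
      then show ?thesis
        by (intro exI[of _ 0] exI[of _ 1]) (auto simp: hat_def)
    next
      case 3
      then show ?thesis
        by (intro exI[of _ 2] exI[of _ "-1"]) (auto simp: hat_def)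
    next
      case 4
      then show ?thesis
        by (intro exI[of _ 0]) (auto simp: hat_def)
    qed
  qed
  then obtain c d where "\<forall>x\<in>I. hat x = c + x * d"
    by blast
  then show "\<exists>u v. \<forall>x\<in>I. seed x = u + x *\<^sub>R v"
    by (intro exI[of _ "c *\<^sub>R axis 2 1"] exI[of _ "d *\<^sub>R axis 2 1"])
      (simp add: seed_eq scaleR_add_left)
qed simp

lemma is_window_seed: "is_window seed 0 2"
  using supp_seed by (auto simp: is_window_def seed_eq hat_def)

section \<open>Matching rows and transition matrices on the window [0, 2]\<close>

definition match :: "nat \<Rightarrow> real mat" where
  "match k = Matrix.mat 1 4 (\<lambda>(i, j). if even j then - shear k else 1)"

lemma match_carrier [simp]: "match k \<in> carrier_mat 1 4" "dim_row (match k) = 1" "dim_col (match k) = 4"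
  by (simp_all add: match_def)

lemma sum_upto_4: "sum f {0..<4::nat} = f 0 + f 1 + f 2 + (f 3 :: 'a :: comm_monoid_add)"
  by (simp add: numeral_eq_Suc)

lemma all_less_4: "(\<forall>i<4::nat. Q i) \<longleftrightarrow> Q 0 \<and> Q 1 \<and> Q 2 \<and> Q 3"
  by (auto simp: numeral_eq_Suc All_less_Suc)

lemma mat_kernel_match:
  "mat_kernel (match k) = {x \<in> carrier_vec 4.
     vec_index x 1 + vec_index x 3 = shear k * (vec_index x 0 + vec_index x 2)}"
proof -
  have "match k *\<^sub>v x = 0\<^sub>v 1 \<longleftrightarrow>
      vec_index x 1 + vec_index x 3 = shear k * (vec_index x 0 + vec_index x 2)"
    if "x \<in> carrier_vec 4" for x
  proof -
    have "vec_index (match k *\<^sub>v x) 0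
        = (vec_index x 1 + vec_index x 3) - shear k * (vec_index x 0 + vec_index x 2)"
      using that by (simp add: match_def scalar_prod_def sum_upto_4 ring_distribs)
    then show ?thesis
      by (simp add: Matrix.vec_eq_iff)
  qed
  then show ?thesis
    unfolding mat_kernel_def by auto
qed

definition phi :: "nat \<Rightarrow> real vec \<Rightarrow> real" where
  "phi k x = vec_index x 1 - shear k * vec_index x 0"

definition kernel_vec :: "real vec" where
  "kernel_vec = Matrix.vec 4 (\<lambda>i. if i = 1 then 1 else if i = 3 then - 1 else 0)"

text \<open>The first component of each block is 0, so the shear does not enter and one vector
  serves both parities; the second components cancel.\<close>

lemma kernel_vec_kernel: "kernel_vec \<in> mat_kernel (match k)"
  by (simp add: mat_kernel_match kernel_vec_def)

lemma phi_kernel_vec [simp]: "phi k kernel_vec = 1"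
  by (simp add: phi_def kernel_vec_def)

lemma vnorm_kernel_vec: "vnorm kernel_vec = sqrt 2"
  by (simp add: vnorm_def kernel_vec_def scalar_prod_def sum_upto_4)

lemma T_mat_carrier [simp]:
  "T_mat switching_mask 0 2 k \<epsilon> \<in> carrier_mat 4 4"
  by (simp add: T_mat_def wdim_def)

text \<open>With left end 0 the offsets cancel: 2(i + 1) - (l + 1) - 1 + \<epsilon> = 2i - l +
  \<epsilon> for 0-based blocks. Even rows vanish because the masks have zero first row.\<close>

lemma T_mat_eq:
  "T_mat switching_mask 0 2 k \<epsilon> = Matrix.mat 4 4 (\<lambda>(m, n).
     let j = 2 * int (m div 2) - int (n div 2) + \<epsilon>
     in if odd m \<and> j \<in> {0, 1, 2} then a_coeff j * (if odd n then 1 else - shear (k + 1)) else 0)"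
  by (rule eq_matI) (auto simp: T_mat_def wdim_def switching_mask_eq component_def Let_def)

text \<open>For \<open>x\<close> in the kernel, the two blocks pair with w_{k+1} to t and -t, where
  t is \<open>phi (k + 1) x\<close>. The scalar hat matrices, with rows (1/2, 0), (1/2, 1) for
  \<epsilon> = 0 and (1, 1/2), (0, 1/2) for \<epsilon> = 1, share the eigenvector (1, -1) with
  eigenvalue 1/2; hence the result is the same for both digits.\<close>

lemma T_mat_kernel:
  assumes "x \<in> mat_kernel (match (k + 1))" "\<epsilon> \<in> {0, 1}"
  shows "T_mat switching_mask 0 2 k \<epsilon> *\<^sub>v x = (phi (k + 1) x / 2) \<cdot>\<^sub>v kernel_vec"
proof -
  have "\<epsilon> = 0 \<or> \<epsilon> = 1"
    using assms(2) by simp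
  moreover have "dim_vec x = 4"
    "vec_index x 3 = shear (k + 1) * (vec_index x 0 + vec_index x 2) - vec_index x 1"
    using assms(1) by (auto simp: mat_kernel_match)
  ultimately show ?thesis
    unfolding Matrix.vec_eq_iff
    by (elim disjE; simp add: T_mat_eq all_less_4 kernel_vec_def a_coeff_def scalar_prod_def
       sum_upto_4 phi_def; simp add: field_simps)
qed

text \<open>As w_k . e_2 = 1 for either parity, \<open>match k\<close> adds up the columns of the
  scalar hat matrix. These sums are 1, which leaves w_{k+1} in each block.\<close>

lemma match_T_mat:
  assumes "\<epsilon> \<in> {0, 1}"
  shows "match k * T_mat switching_mask 0 2 k \<epsilon> = match (k + 1)"
proof -
  have "\<epsilon> = 0 \<or> \<epsilon> = 1"
    using assms by simp
  then show ?thesis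
    unfolding mat_eq_iff
    by (elim disjE; simp add: T_mat_eq all_less_4 match_def
       a_coeff_def scalar_prod_def sum_upto_4)
qed

lemma abs_vec_index_le_vnorm:
  assumes "i < dim_vec x"
  shows "\<bar>vec_index x i\<bar> \<le> vnorm x"
proof -
  have "(vec_index x i)\<^sup>2 \<le> x \<bullet> x"
    using assms member_le_sum[of i "{0..<dim_vec x}" "\<lambda>i. vec_index x i * vec_index x i"]
    by (simp add: scalar_prod_def power2_eq_square)
  then show ?thesis
    unfolding vnorm_def using real_sqrt_le_mono by fastforce
qed

lemma abs_phi_le:
  assumes "x \<in> carrier_vec 4"
  shows "\<bar>phi k x\<bar> \<le> 2 * vnorm x"
proof -
  have "\<bar>phi k x\<bar> \<le> \<bar>vec_index x 1\<bar> + \<bar>vec_index x 0\<bar>"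
    by (cases "even k") (auto simp: phi_def shear_def)
  also have "\<dots> \<le> 2 * vnorm x"
    using abs_vec_index_le_vnorm[of 0 x] abs_vec_index_le_vnorm[of 1 x] assms by simp
  finally show ?thesis .
qed

lemma opnorm_match: "opnorm (match k) \<le> 4"
proof (rule opnorm_le)
  fix x :: "real vec" assume "x \<in> carrier_vec (dim_col (match k))"
  then have x: "x \<in> carrier_vec 4"
    by simp
  then have "match k *\<^sub>v x = Matrix.vec 1
      (\<lambda>_. vec_index x 1 + vec_index x 3 - shear k * (vec_index x 0 + vec_index x 2))"
    by (intro eq_vecI) (simp_all add: match_def scalar_prod_def sum_upto_4 ring_distribs)
  then have "vnorm (match k *\<^sub>v x)
      = \<bar>vec_index x 1 + vec_index x 3 - shear k * (vec_index x 0 + vec_index x 2)\<bar>"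
    by (simp add: vnorm_def scalar_prod_def)
  also have "\<dots> \<le> \<bar>vec_index x 0\<bar> + \<bar>vec_index x 1\<bar> + \<bar>vec_index x 2\<bar> + \<bar>vec_index x 3\<bar>"
    by (cases "even k") (auto simp: shear_def)
  also have "\<dots> \<le> 4 * vnorm x"
    using abs_vec_index_le_vnorm[of 0 x] abs_vec_index_le_vnorm[of 1 x]
      abs_vec_index_le_vnorm[of 2 x] abs_vec_index_le_vnorm[of 3 x] x by simp
  finally show "vnorm (match k *\<^sub>v x) \<le> 4 * vnorm x" .
qed simp

lemma eigenvalue_dim_1:
  fixes A :: "'a :: field mat"
  assumes "A \<in> carrier_mat 1 1"
  shows "eigenvalue A \<mu> \<longleftrightarrow> \<mu> = A $$ (0, 0)"
proof -
  have "char_matrix A \<mu> \<in> carrier_mat 1 1"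
    using assms by simp
  then have "det (char_matrix A \<mu>) = A $$ (0, 0) - \<mu>"
    using assms by (simp add: det_single char_matrix_def)
  then show ?thesis
    using assms by (auto simp: eigenvalue_det)
qed

text \<open>A single row has a 1 x 1 Gram matrix, so its only singular value is its length, the root
  of 2 + 2 s_k^2.\<close>

lemma sigma_min_match: "sqrt 2 \<le> sigma_min (match k)"
proof -
  let ?G = "match k * transpose_mat (match k)"
  have G: "?G \<in> carrier_mat 1 1"
    by (intro mult_carrier_mat[of _ _ 4]) auto
  have "?G $$ (0, 0) = 2 + 2 * (shear k)\<^sup>2"
    by (simp add: match_def scalar_prod_def sum_upto_4 power2_eq_square)
  then have "{\<mu>. eigenvalue ?G \<mu>} = {2 + 2 * (shear k)\<^sup>2}"
    using eigenvalue_dim_1[OF G] by auto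
  then show ?thesis
    by (simp add: sigma_min_def)
qed

lemma rank_match: "vec_space.rank 1 (match k) = 1"
proof (rule antisym)
  show "vec_space.rank 1 (match k) \<le> 1"
    by (rule vec_space.rank_le_1_product_entries[of _ 1 4 "\<lambda>_. 1" "\<lambda>j. match k $$ (0, j)"])
      (auto simp: match_def)
  \<comment> \<open>Column 1 of \<open>match k\<close> is the vector (1), the only row of the 1 x 1
    identity. Independence is read off from that triangular matrix with nonzero diagonal.\<close>
  have "upper_triangular (1\<^sub>m 1 :: real mat)" "0 \<notin> set (diag_mat (1\<^sub>m 1 :: real mat))"
    by (auto simp: diag_mat_def)
  from idom_vec.upper_triangular_imp_lin_indpt_rows[OF one_carrier_mat this]
  have "\<not> module.lin_dep class_ring (module_vec TYPE(real) 1) (set (rows (1\<^sub>m 1)))" .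
  moreover have "set (rows (1\<^sub>m 1)) = {col (match k) 1}"
    by (auto simp: rows_def match_def Matrix.vec_eq_iff)
  moreover have "col (match k) 1 \<in> set (cols (match k))"
    by (auto simp: cols_def)
  ultimately show "1 \<le> vec_space.rank 1 (match k)"
    using vec_space.rank_ge_card_indpt[of "match k" 1 4 "{col (match k) 1}"]
    by (simp del: One_nat_def)
qed

lemma matching_maps_match: "matching_maps (wdim 0 2) 1 match"
  unfolding matching_maps_def
proof (intro conjI allI impI)
  show "\<exists>c>0. \<forall>k\<ge>1. c \<le> sigma_min (match k)"
    using sigma_min_match by (intro exI[of _ "sqrt 2"]) simp
  show "\<exists>c. \<forall>k\<ge>1. opnorm (match k) \<le> c"
    using opnorm_match by blast
qed (simp_all add: wdim_def rank_match del: One_nat_def)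

section \<open>Explicit orthonormal bases of the kernels\<close>

text \<open>The third condition puts the range of \<open>U\<close> inside the kernel; the fourth
  exhibits each kernel vector as an element of that range.\<close>

lemma kernel_onbI:
  assumes "dim_row U = dim_col P" "transpose_mat U * U = 1\<^sub>m (dim_col U)"
    and "P * U = 0\<^sub>m (dim_row P) (dim_col U)"
    and "\<And>x. x \<in> mat_kernel P \<Longrightarrow> U *\<^sub>v (transpose_mat U *\<^sub>v x) = x"
  shows "kernel_onb P U"
  unfolding kernel_onb_iff
proof (intro conjI subset_antisym subsetI)
  fix x assume "x \<in> mat_kernel P"
  then have "x = U *\<^sub>v (transpose_mat U *\<^sub>v x)"
    using assms(4) by simp
  moreover have "transpose_mat U *\<^sub>v x \<in> carrier_vec (dim_col U)"
    by (rule carrier_vecI) simp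
  ultimately show "x \<in> (\<lambda>y. U *\<^sub>v y) ` carrier_vec (dim_col U)"
    by (rule image_eqI)
next
  fix x assume "x \<in> (\<lambda>y. U *\<^sub>v y) ` carrier_vec (dim_col U)"
  then obtain y where y: "y \<in> carrier_vec (dim_col U)" "x = U *\<^sub>v y"
    by blast
  have "P *\<^sub>v x = (P * U) *\<^sub>v y"
    unfolding y(2) by (rule assoc_mult_mat_vec[symmetric]) (use assms(1) y(1) in auto)
  also have "\<dots> = 0\<^sub>v (dim_row P)"
    unfolding assms(3) by (rule eq_vecI) (use y(1) in auto)
  finally show "x \<in> mat_kernel P"
    using assms(1) y(2) by (auto simp: mat_kernel_def intro: carrier_vecI)
qed (use assms in auto)

text \<open>For even \<open>k\<close> the columns are the normalised sign vectors orthogonal to (-1,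
  1, -1, 1) and to each other; for odd \<open>k\<close> they are e_0, e_2 and
  \<open>kernel_vec\<close> divided by sqrt 2. They show that the claims about all kernel bases are
  not vacuous.\<close>

definition match_onb :: "nat \<Rightarrow> real mat" where
  "match_onb k = (if even k
     then mat_of_rows_list 3 [[1/2, 1/2, 1/2], [1/2, 1/2, -1/2], [1/2, -1/2, -1/2], [1/2, -1/2, 1/2]]
     else mat_of_rows_list 3 [[1, 0, 0], [0, 0, sqrt (1/2)], [0, 1, 0], [0, 0, - sqrt (1/2)]])"

lemma sum_upto_3: "sum f {0..<3::nat} = f 0 + f 1 + (f 2 :: 'a :: comm_monoid_add)"
  by (simp add: numeral_eq_Suc)

lemma all_less_3: "(\<forall>i<3::nat. Q i) \<longleftrightarrow> Q 0 \<and> Q 1 \<and> Q 2"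
  by (auto simp: numeral_eq_Suc All_less_Suc)

lemma kernel_onb_match_onb: "kernel_onb (match k) (match_onb k)"
proof (rule kernel_onbI)
  have q: "sqrt (1/2) * sqrt (1/2) = 1/2" "sqrt (1/2) * (sqrt (1/2) * c) = c / 2" for c :: real
    by (simp_all flip: mult.assoc)
  show "dim_row (match_onb k) = dim_col (match k)"
    by (simp add: match_onb_def mat_of_rows_list_def)
  show "transpose_mat (match_onb k) * match_onb k = 1\<^sub>m (dim_col (match_onb k))"
    by (simp add: mat_eq_iff all_less_3 match_onb_def mat_of_rows_list_def scalar_prod_def sum_upto_4 q)
  show "match k * match_onb k = 0\<^sub>m (dim_row (match k)) (dim_col (match_onb k))"
    by (simp add: mat_eq_iff all_less_3 match_onb_def match_def shear_def mat_of_rows_list_def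
        scalar_prod_def sum_upto_4)
  fix x assume "x \<in> mat_kernel (match k)"
  then have x: "dim_vec x = 4"
    "vec_index x 3 = shear k * (vec_index x 0 + vec_index x 2) - vec_index x 1"
    by (auto simp: mat_kernel_match)
  show "match_onb k *\<^sub>v (transpose_mat (match_onb k) *\<^sub>v x) = x"
    by (simp add: Matrix.vec_eq_iff all_less_4 match_onb_def mat_of_rows_list_def scalar_prod_def
        sum_upto_4 sum_upto_3 x shear_def q ring_distribs)
qed

section \<open>Chronological products for arbitrary kernel bases\<close>

lemma phi_smult: "x \<in> carrier_vec 4 \<Longrightarrow> phi k (c \<cdot>\<^sub>v x) = c * phi k x"
  by (simp add: phi_def algebra_simps)

lemma kernel_vec_carrier [simp]: "kernel_vec \<in> carrier_vec 4"
  by (simp add: kernel_vec_def)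

abbreviation switching_T :: "nat \<Rightarrow> int \<Rightarrow> real mat" where
  "switching_T \<equiv> T_mat switching_mask 0 2"

lemma kernel_onb_match_carrier:
  assumes "kernel_onb (match k) U"
  shows "U \<in> carrier_mat 4 (dim_col U)" "transpose_mat U \<in> carrier_mat (dim_col U) 4"
proof -
  have "dim_row U = 4"
    using assms by (simp add: kernel_onb_def)
  then show "U \<in> carrier_mat 4 (dim_col U)"
    by (intro carrier_matI) simp_all
  then show "transpose_mat U \<in> carrier_mat (dim_col U) 4"
    by (simp only: transpose_carrier_mat)
qed

context
  fixes U :: "nat \<Rightarrow> real mat"
  assumes U: "\<And>k. 1 \<le> k \<Longrightarrow> kernel_onb (match k) (U k)"
begin

lemma chron_factor_carrier:
  assumes "1 \<le> a"
  shows "chron_factor switching_T U a \<epsilon> \<in> carrier_mat (dim_col (U a)) (dim_col (U (a + 1)))"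
  unfolding chron_factor_def
  by (rule mult_carrier_mat[OF mult_carrier_mat[OF kernel_onb_match_carrier(2)[OF U] T_mat_carrier]
        kernel_onb_match_carrier(1)[OF U]])
    (use assms in simp_all)

text \<open>\<open>U (a + 1)\<close> maps into the kernel on which the transition matrix has the
  rank-one form of \<open>T_mat_kernel\<close>.\<close>

lemma chron_factor_apply:
  assumes "1 \<le> a" "\<epsilon> \<in> {0, 1}" "y \<in> carrier_vec (dim_col (U (a + 1)))"
  shows "chron_factor switching_T U a \<epsilon> *\<^sub>v y
    = (phi (a + 1) (U (a + 1) *\<^sub>v y) / 2) \<cdot>\<^sub>v (transpose_mat (U a) *\<^sub>v kernel_vec)"
proof -
  have Ua: "transpose_mat (U a) \<in> carrier_mat (dim_col (U a)) 4"
    by (rule kernel_onb_match_carrier(2)[OF U[OF assms(1)]])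
  have Ua1: "U (a + 1) \<in> carrier_mat 4 (dim_col (U (a + 1)))"
    by (rule kernel_onb_match_carrier(1)[OF U]) simp
  have "chron_factor switching_T U a \<epsilon> *\<^sub>v y
      = (transpose_mat (U a) * switching_T a \<epsilon>) *\<^sub>v (U (a + 1) *\<^sub>v y)"
    unfolding chron_factor_def
    by (rule assoc_mult_mat_vec[OF mult_carrier_mat[OF Ua T_mat_carrier] Ua1 assms(3)])
  also have "\<dots> = transpose_mat (U a) *\<^sub>v (switching_T a \<epsilon> *\<^sub>v (U (a + 1) *\<^sub>v y))"
    by (rule assoc_mult_mat_vec[OF Ua T_mat_carrier mult_mat_vec_carrier[OF Ua1 assms(3)]])
  also have "switching_T a \<epsilon> *\<^sub>v (U (a + 1) *\<^sub>v y) = (phi (a + 1) (U (a + 1) *\<^sub>v y) / 2) \<cdot>\<^sub>v kernel_vec"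
    by (rule T_mat_kernel[OF kernel_onb_mult(1)[OF U assms(3)] assms(2)]) simp
  also have "transpose_mat (U a) *\<^sub>v \<dots>
      = (phi (a + 1) (U (a + 1) *\<^sub>v y) / 2) \<cdot>\<^sub>v (transpose_mat (U a) *\<^sub>v kernel_vec)"
    by (rule mult_mat_vec[OF Ua kernel_vec_carrier])
  finally show ?thesis .
qed

lemma chron_product_carrier:
  assumes "1 \<le> a"
  shows "chron_product switching_T U a es \<in> carrier_mat (dim_col (U a)) (dim_col (U (a + length es)))"
  using assms
proof (induction es arbitrary: a)
  case (Cons \<epsilon> es)
  have "chron_product switching_T U (a + 1) es
      \<in> carrier_mat (dim_col (U (a + 1))) (dim_col (U (a + 1 + length es)))"
    by (rule Cons.IH) simp
  from mult_carrier_mat[OF chron_factor_carrier[OF Cons.prems] this] show ?case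
    by simp
qed simp

text \<open>Each factor outputs a multiple of the coordinates of \<open>kernel_vec\<close>, on which
  the next factor to the left contributes exactly 1/2 because \<open>phi\<close> is 1 there. The
  empty product is the identity and does not have this rank-one form.\<close>

lemma chron_product_apply:
  assumes "1 \<le> a" "set es \<subseteq> {0, 1}" "es \<noteq> []" "y \<in> carrier_vec (dim_col (U (a + length es)))"
  shows "chron_product switching_T U a es *\<^sub>v y
    = ((1 / 2) ^ length es * phi (a + length es) (U (a + length es) *\<^sub>v y))
        \<cdot>\<^sub>v (transpose_mat (U a) *\<^sub>v kernel_vec)"
  using assms
proof (induction es arbitrary: a)
  case (Cons \<epsilon> es)
  have \<epsilon>: "\<epsilon> \<in> {0, 1}"
    using Cons.prems(2) by simp
  show ?case
  \<comment> \<open>The formula starts at length 1, so a single factor is the actual base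
    case.\<close>
  proof (cases "es = []")
    case True
    then have y: "y \<in> carrier_vec (dim_col (U (a + 1)))"
      using Cons.prems(4) by simp
    have "chron_product switching_T U a (\<epsilon> # es) = chron_factor switching_T U a \<epsilon>"
      using True right_mult_one_mat[OF chron_factor_carrier[OF Cons.prems(1), of \<epsilon>]] by simp
    then show ?thesis
      using chron_factor_apply[OF Cons.prems(1) \<epsilon> y] True by simp
  next
    case False
    let ?w = "transpose_mat (U (a + 1)) *\<^sub>v kernel_vec"
    let ?c = "(1 / 2) ^ length es * phi (a + 1 + length es) (U (a + 1 + length es) *\<^sub>v y)"
    have y: "y \<in> carrier_vec (dim_col (U (a + 1 + length es)))"
      using Cons.prems(4) by simp
    have IH: "chron_product switching_T U (a + 1) es *\<^sub>v y = ?c \<cdot>\<^sub>v ?w"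
      by (rule Cons.IH) (use Cons.prems(2) False y in auto)
    have w: "?w \<in> carrier_vec (dim_col (U (a + 1)))"
      by (rule carrier_vecI) simp
    have Ua1: "U (a + 1) \<in> carrier_mat 4 (dim_col (U (a + 1)))"
      by (rule kernel_onb_match_carrier(1)[OF U]) simp
    have "U (a + 1) *\<^sub>v (?c \<cdot>\<^sub>v ?w) = ?c \<cdot>\<^sub>v (U (a + 1) *\<^sub>v ?w)"
      by (rule mult_mat_vec[OF Ua1 w])
    \<comment> \<open>Coordinates lose nothing here because \<open>kernel_vec\<close> lies in every
      kernel, although the kernels alternate.\<close>
    also have "U (a + 1) *\<^sub>v ?w = kernel_vec"
      by (rule kernel_onb_transpose_mult(1)[OF U kernel_vec_kernel]) simp
    finally have "phi (a + 1) (U (a + 1) *\<^sub>v (?c \<cdot>\<^sub>v ?w)) = ?c"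
      by (simp add: phi_smult)
    moreover have "chron_product switching_T U a (\<epsilon> # es) *\<^sub>v y
        = chron_factor switching_T U a \<epsilon> *\<^sub>v (?c \<cdot>\<^sub>v ?w)"
      unfolding chron_product.simps IH[symmetric]
      by (rule assoc_mult_mat_vec[OF chron_factor_carrier[OF Cons.prems(1)] chron_product_carrier y]) simp
    moreover have "chron_factor switching_T U a \<epsilon> *\<^sub>v (?c \<cdot>\<^sub>v ?w)
        = (phi (a + 1) (U (a + 1) *\<^sub>v (?c \<cdot>\<^sub>v ?w)) / 2) \<cdot>\<^sub>v (transpose_mat (U a) *\<^sub>v kernel_vec)"
      by (rule chron_factor_apply[OF Cons.prems(1) \<epsilon>]) (use w in simp)
    ultimately show ?thesis
      by simp
  qed
qed simp

lemma vnorm_chron_product: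
  assumes "1 \<le> a" "set es \<subseteq> {0, 1}" "es \<noteq> []" "y \<in> carrier_vec (dim_col (U (a + length es)))"
  shows "vnorm (chron_product switching_T U a es *\<^sub>v y)
    = (1 / 2) ^ length es * \<bar>phi (a + length es) (U (a + length es) *\<^sub>v y)\<bar> * sqrt 2"
proof -
  have "vnorm (transpose_mat (U a) *\<^sub>v kernel_vec) = sqrt 2"
    using kernel_onb_transpose_mult(2)[OF U[OF assms(1)] kernel_vec_kernel] vnorm_kernel_vec by simp
  then show ?thesis
    by (simp add: chron_product_apply[OF assms] vnorm_smult abs_mult)
qed

lemma vnorm_chron_product_le:
  assumes "1 \<le> a" "set es \<subseteq> {0, 1}" "es \<noteq> []" "y \<in> carrier_vec (dim_col (U (a + length es)))"
  shows "vnorm (chron_product switching_T U a es *\<^sub>v y) \<le> (2 * sqrt 2 * (1 / 2) ^ length es) * vnorm y"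
proof -
  have onb: "kernel_onb (match (a + length es)) (U (a + length es))"
    using U assms(1) by simp
  have "\<bar>phi (a + length es) (U (a + length es) *\<^sub>v y)\<bar> \<le> 2 * vnorm (U (a + length es) *\<^sub>v y)"
    by (rule abs_phi_le) (rule mult_mat_vec_carrier[OF kernel_onb_match_carrier(1)[OF onb] assms(4)])
  also have "vnorm (U (a + length es) *\<^sub>v y) = vnorm y"
    by (rule kernel_onb_mult(3)[OF onb assms(4)])
  finally have "(1 / 2) ^ length es * \<bar>phi (a + length es) (U (a + length es) *\<^sub>v y)\<bar> * sqrt 2
      \<le> (1 / 2) ^ length es * (2 * vnorm y) * sqrt 2"
    by (intro mult_left_mono mult_right_mono) simp_all
  then show ?thesis
    by (simp add: vnorm_chron_product[OF assms] mult_ac)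
qed

text \<open>In the upper constant, 2 bounds \<open>phi\<close> and sqrt 2 is the length of
  \<open>kernel_vec\<close>.\<close>

lemma opnorm_chron_product:
  assumes "1 \<le> a" "set es \<subseteq> {0, 1}" "es \<noteq> []"
  shows "opnorm (chron_product switching_T U a es) \<le> 2 * sqrt 2 * (1 / 2) ^ length es"
    and "(1 / 2) ^ length es \<le> opnorm (chron_product switching_T U a es)"
proof -
  let ?A = "chron_product switching_T U a es" and ?V = "U (a + length es)"
  have dim: "dim_col ?A = dim_col ?V"
    using chron_product_carrier[OF assms(1)] by blast
  have bound: "vnorm (?A *\<^sub>v y) \<le> (2 * sqrt 2 * (1 / 2) ^ length es) * vnorm y"
    if "y \<in> carrier_vec (dim_col ?A)" for y
    using vnorm_chron_product_le[OF assms] that dim by simp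
  show "opnorm ?A \<le> 2 * sqrt 2 * (1 / 2) ^ length es"
    by (rule opnorm_le[OF bound]) simp_all
  have onb: "kernel_onb (match (a + length es)) ?V"
    using U assms(1) by simp
  let ?w = "transpose_mat ?V *\<^sub>v kernel_vec"
  \<comment> \<open>The unit vector along \<open>kernel_vec\<close>, in coordinates:
    \<open>phi\<close> equals 1 / sqrt 2 on it, which cancels the sqrt 2 in the norm of the
    image.\<close>
  let ?y = "(1 / sqrt 2) \<cdot>\<^sub>v ?w"
  have w: "?w \<in> carrier_vec (dim_col ?V)"
    by (rule carrier_vecI) simp
  then have y: "?y \<in> carrier_vec (dim_col ?V)"
    by simp
  have norm: "vnorm ?y = 1"
    by (simp add: vnorm_smult kernel_onb_transpose_mult(2)[OF onb kernel_vec_kernel] vnorm_kernel_vec)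
  have "?V *\<^sub>v ?y = (1 / sqrt 2) \<cdot>\<^sub>v (?V *\<^sub>v ?w)"
    by (rule mult_mat_vec[OF kernel_onb_match_carrier(1)[OF onb] w])
  then have "phi (a + length es) (?V *\<^sub>v ?y) = 1 / sqrt 2"
    by (simp add: kernel_onb_transpose_mult(1)[OF onb kernel_vec_kernel] phi_smult)
  then have "(1 / 2) ^ length es = vnorm (?A *\<^sub>v ?y)"
    by (simp add: vnorm_chron_product[OF assms y])
  also have "\<dots> \<le> opnorm ?A"
    by (rule vnorm_mult_le_opnorm[OF bound]) (use y norm dim in simp_all)
  finally show "(1 / 2) ^ length es \<le> opnorm ?A" .
qed

lemma chi_bounds:
  assumes "1 \<le> m"
  shows "(1 / 2) ^ m \<le> chi switching_T U m" "chi switching_T U m \<le> 2 * sqrt 2 * (1 / 2) ^ m"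
proof -
  let ?E = "{es :: int list. length es = m \<and> set es \<subseteq> {0, 1}}"
  define F where "F a = (MAX es\<in>?E. opnorm (chron_product switching_T U a es))" for a
  have chi: "chi switching_T U m = (SUP a\<in>{1..}. F a)"
    by (simp add: chi_def F_def)
  have fin: "finite ?E"
    using finite_lists_length_eq[of "{0, 1 :: int}" m] by (simp add: conj_commute)
  \<comment> \<open>The all-zero word makes the maximum meaningful and, started at 1, gives the
    lower bound.\<close>
  have mem: "replicate m 0 \<in> ?E"
    by auto
  then have ne: "?E \<noteq> {}"
    by blast
  have upper: "F a \<le> 2 * sqrt 2 * (1 / 2) ^ m" if "1 \<le> a" for a
  proof -
    have "opnorm (chron_product switching_T U a es) \<le> 2 * sqrt 2 * (1 / 2) ^ m" if "es \<in> ?E" for es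
      using opnorm_chron_product(1)[OF \<open>1 \<le> a\<close>, of es] that assms by fastforce
    then show ?thesis
      unfolding F_def by (subst Max_le_iff) (use fin ne in auto)
  qed
  show "chi switching_T U m \<le> 2 * sqrt 2 * (1 / 2) ^ m"
    unfolding chi by (rule cSUP_least) (use upper in auto)
  have "(1 / 2) ^ m \<le> opnorm (chron_product switching_T U 1 (replicate m 0))"
    using opnorm_chron_product(2)[of 1 "replicate m 0"] assms by auto
  also have "\<dots> \<le> F 1"
    unfolding F_def by (rule Max_ge) (use fin mem in auto)
  \<comment> \<open>The bound \<open>upper\<close> is uniform in the starting index, so the supremum
    is over a bounded set.\<close>
  also have "\<dots> \<le> chi switching_T U m"
    unfolding chi by (rule cSUP_upper) (use upper in \<open>auto intro!: bdd_aboveI2\<close>)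
  finally show "(1 / 2) ^ m \<le> chi switching_T U m" .
qed

text \<open>The m-th roots of the bounds are 1/2 and 1/2 times the m-th root of a positive constant,
  which tends to 1.\<close>

lemma has_chron_radius_switching: "has_chron_radius switching_T U (1 / 2)"
  unfolding has_chron_radius_def
proof (rule tendsto_sandwich)
  have root_pow: "root m ((1 / 2) ^ m) = 1 / 2" if "1 \<le> m" for m
    using that by (simp add: real_root_power_cancel)
  show "\<forall>\<^sub>F m in sequentially. 1 / 2 \<le> root m (chi switching_T U m)"
    using eventually_ge_at_top[of 1]
  proof eventually_elim
    case (elim m)
    then show ?case
      using real_root_le_mono[of m, OF _ chi_bounds(1)[OF elim]] root_pow[OF elim] by simp
  qed
  show "\<forall>\<^sub>F m in sequentially. root m (chi switching_T U m) \<le> root m (2 * sqrt 2) * (1 / 2)"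
    using eventually_ge_at_top[of 1]
  proof eventually_elim
    case (elim m)
    then show ?case
      using real_root_le_mono[of m, OF _ chi_bounds(2)[OF elim]] root_pow[OF elim]
      by (simp add: real_root_mult)
  qed
  have "(\<lambda>m. root m (2 * sqrt 2)) \<longlonglongrightarrow> 1"
    by (rule LIMSEQ_root_const) simp
  from tendsto_mult[OF this tendsto_const[of "1 / 2"]]
  show "(\<lambda>m. root m (2 * sqrt 2) * (1 / 2)) \<longlonglongrightarrow> 1 / 2"
    by simp
qed simp

end

section \<open>Zero defect, distinct kernels and the conclusion\<close>

text \<open>The first summand vanishes by the exact identity \<open>match_T_mat\<close>, the second
  because the seed is fixed by \<open>V_op\<close>.\<close>

lemma defect_switching:
  "defect switching_mask seed 0 2 match U k = 0"
proof -
  have "opnorm ((match k * switching_T k \<epsilon> - match (k + 1)) * S_mat match U (k + 1)) = 0"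
    if "\<epsilon> \<in> {0, 1}" for \<epsilon>
  proof -
    have "match k * switching_T k \<epsilon> - match (k + 1) = 0\<^sub>m 1 4"
      unfolding match_T_mat[OF that] by (rule minus_r_inv_mat[OF match_carrier(1)])
    moreover have "0\<^sub>m 1 4 * S_mat match U (k + 1) = 0\<^sub>m 1 (dim_col (S_mat match U (k + 1)))"
      by (rule left_mult_zero_mat, intro carrier_matI) (simp_all add: S_mat_def)
    ultimately show ?thesis
      by (simp only: opnorm_zero)
  qed
  then have "(MAX \<epsilon>\<in>{0, 1}.
      opnorm ((match k * switching_T k \<epsilon> - match (k + 1)) * S_mat match U (k + 1))) = 0"
    by simp
  moreover have "vnorm (match k *\<^sub>v G_vec 0 2 (\<lambda>x. V_op switching_mask k seed x - seed x) t) = 0" for t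
  proof -
    have "G_vec 0 2 (\<lambda>x. V_op switching_mask k seed x - seed x) t = 0\<^sub>v 4"
      by (rule eq_vecI) (simp_all add: G_vec_def V_op_seed wdim_def)
    moreover have "match k *\<^sub>v 0\<^sub>v 4 = 0\<^sub>v 1"
      by (rule eq_vecI) (simp_all add: scalar_prod_def)
    ultimately show ?thesis
      by simp
  qed
  ultimately show ?thesis
    by (simp add: defect_def)
qed

lemma mat_kernel_match_distinct: "mat_kernel (match 0) \<noteq> mat_kernel (match 1)"
proof -
  \<comment> \<open>The first coordinate enters the kernel equation with coefficient s_k, which
    tells the parities apart.\<close>
  have "unit_vec 4 0 \<in> mat_kernel (match 1)" "unit_vec 4 0 \<notin> mat_kernel (match 0)"
    by (simp_all add: mat_kernel_match shear_def)
  then show ?thesis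
    by blast
qed

theorem proposition2p4:
  shows "\<exists>(g :: real \<Rightarrow> real ^ 2) (lm :: int) (lp :: int) (r :: nat) (P :: nat \<Rightarrow> real mat).
     cpwl g \<and> compact (supp g)
   \<and> is_window g lm lp
   \<and> matching_maps (wdim lm lp) r P
   \<and> (\<exists>U. \<forall>k\<ge>1. kernel_onb (P k) (U k))
   \<and> (\<forall>U. (\<forall>k\<ge>1. kernel_onb (P k) (U k)) \<longrightarrow>
         (\<forall>k\<ge>1. defect switching_mask g lm lp P U k = 0)
       \<and> has_chron_radius (T_mat switching_mask lm lp) U (1 / 2))
   \<and> (\<exists>\<Phi>. uniform_limit UNIV (\<lambda>n. foldr (V_op switching_mask) [1..<n + 1] g) \<Phi> sequentially
         \<and> (\<exists>x. \<Phi> x \<noteq> 0))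
   \<and> (\<exists>K K'. K \<noteq> K' \<and> (\<forall>k\<ge>1. mat_kernel (P k) = (if even k then K else K')))"
proof (intro exI conjI allI impI)
  \<comment> \<open>The witnesses are \<open>seed\<close>, the window [0, 2], r = 1 and
    \<open>match\<close>.\<close>
  have "bounded {x. seed x \<noteq> 0}"
    using supp_seed bounded_subset[of "{0..2}" "{x. seed x \<noteq> 0}"] closure_subset[of "{x. seed x \<noteq> 0}"]
    by (auto simp: supp_def)
  then show "compact (supp seed)"
    by (simp add: supp_def)
  show "kernel_onb (match k) (match_onb k)" for k
    by (rule kernel_onb_match_onb)
  show "has_chron_radius switching_T U (1 / 2)" if "\<forall>k\<ge>1. kernel_onb (match k) (U k)" for U
    using that by (intro has_chron_radius_switching) simp
  \<comment> \<open>The sequence of iterates is constant, so its limit is the seed itself.\<close>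
  show "uniform_limit UNIV (\<lambda>n. foldr (V_op switching_mask) [1..<n + 1] seed) seed sequentially"
    unfolding foldr_V_op_seed by (intro uniform_limit_intros)
  show "seed 1 \<noteq> 0"
    by (simp add: seed_eq hat_def axis_eq_0_iff)
  \<comment> \<open>Indices 0 and 1 represent the two parities; \<open>match 0\<close> is defined by
    the same formula, although the claim starts at 1.\<close>
  show "mat_kernel (match 0) \<noteq> mat_kernel (match 1)"
    by (rule mat_kernel_match_distinct)
  show "mat_kernel (match k) = (if even k then mat_kernel (match 0) else mat_kernel (match 1))" for k
    by (simp add: mat_kernel_match shear_def)
qed (rule cpwl_seed is_window_seed matching_maps_match defect_switching)+

end
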